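(* For any positive integer $n$ and any $u=(m_1,\dots,m_n)\in(\mathbb{Z}_{>0})^n$ with $m_i>2$ for all $i$, the quandle Euler characteristic of the discrete torus $DT^n_u$ satisfies $\chi^{\mathrm{Qdle}}(DT^n_u)=\chi^{\mathrm{Top}}(T^n)=0$, where $T^n=(S^1)^n$ is the flat $n$-torus.
   Context: A quandle is a pair $(X,s)$ of a non-empty set $X$ and a map $s : X \to \mathrm{Map}(X,X)$, $x \mapsto s_x$ (where $\mathrm{Map}(X,X)$ is the set of all maps $X\to X$) such that: (1) $s_x(x)=x$ for all $x\in X$; (2) each $s_x$ is a bijection; (3) $s_x\circ s_y = s_{s_x(y)}\circ s_x$ for all $x,y\in X$. The displacement group $\mathrm{Dis}(X)$ is the group of bijections of $X$ generated under composition by $\{s_x\circ s_y^{-1} \mid x,y\in X\}$. For $g\in \mathrm{Dis}(X)$, $\mathrm{Fix}(g,X)=\{x\in X\mid g(x)=x\}$. The quandle Euler characteristic is $\chi^{\mathrm{Qdle}}(X)=\inf\{\#\mathrm{Fix}(g,X)\mid g\in \mathrm{Dis}(X)\}$, where $\#$ denotes cardinality. $\chi^{\mathrm{Top}}$ denotes the usual topological Euler characteristic. For a positive integer $m$, the dihedral quandle $R_m$ is the set $\mathbb{Z}/m\mathbb{Z}$ with $s_h(g)=h+\sigma(g-h)$ where $\sigma(a)=-a$, i.e. $s_h(g)=2h-g$. The direct product of quandles is the product set with componentwise structure, $s_{(x_1,\dots,x_n)}(y_1,\dots,y_n)=(s_{x_1}(y_1),\dots,s_{x_n}(y_n))$.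 For $u=(m_1,\dots,m_n)\in(\mathbb{Z}_{>0})^n$, the discrete torus is the direct product quandle $DT^n_u=\prod_{k=1}^n R_{m_k}$. *)

theory Defs
  imports
    "HOL-Homology.Homology"
    "HOL-Algebra.Bij"
    "HOL-Algebra.Generated_Groups"
    "HOL-Library.Extended_Real"
begin

section \<open>Quandles\<close>

record 'a quandle_structure = "'a partial_object" +
  act :: "'a \<Rightarrow> 'a \<Rightarrow> 'a"

text \<open>
  The map $s_x : X \to X$ is \<open>act Q x\<close>. As elsewhere in HOL-Algebra, self-maps of the carrier
  are represented by extensional functions, so that \<open>Bij (carrier Q)\<close> is exactly the set of
  bijections of $X$.
\<close>

locale quandle =
  fixes Q :: "('a, 'b) quandle_structure_scheme"
  assumes nonempty: "carrier Q \<noteq> {}"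
    and act_self: "x \<in> carrier Q \<Longrightarrow> act Q x x = x"
    and act_Bij: "x \<in> carrier Q \<Longrightarrow> act Q x \<in> Bij (carrier Q)"
    and act_act: "\<lbrakk>x \<in> carrier Q; y \<in> carrier Q; z \<in> carrier Q\<rbrakk>
          \<Longrightarrow> act Q x (act Q y z) = act Q (act Q x y) (act Q x z)"

definition displacement_group :: "('a, 'b) quandle_structure_scheme \<Rightarrow> ('a \<Rightarrow> 'a) monoid" where
  "displacement_group Q =
     subgroup_generated (BijGroup (carrier Q))
       {act Q x \<otimes>\<^bsub>BijGroup (carrier Q)\<^esub> inv\<^bsub>BijGroup (carrier Q)\<^esub> (act Q y) | x y.
          x \<in> carrier Q \<and> y \<in> carrier Q}"

definition fixed_points :: "('a \<Rightarrow> 'a) \<Rightarrow> ('a, 'b) quandle_structure_scheme \<Rightarrow> 'a set" where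
  "fixed_points g Q = {x \<in> carrier Q. g x = x}"

definition ecard :: "'a set \<Rightarrow> enat" where
  "ecard A = (if finite A then enat (card A) else \<infinity>)"

definition quandle_euler_char :: "('a, 'b) quandle_structure_scheme \<Rightarrow> enat" where
  "quandle_euler_char Q = (INF g\<in>carrier (displacement_group Q). ecard (fixed_points g Q))"

text \<open>$\mathbb{Z}/m\mathbb{Z}$ is represented by the residues $0, \dots, m-1$.\<close>

definition dihedral_quandle :: "nat \<Rightarrow> int quandle_structure" where
  "dihedral_quandle m =
     \<lparr>carrier = {0..<int m}, act = (\<lambda>h. \<lambda>g\<in>{0..<int m}. (2 * h - g) mod int m)\<rparr>"

definition product_quandle ::
    "'i set \<Rightarrow> ('i \<Rightarrow> 'a quandle_structure) \<Rightarrow> ('i \<Rightarrow> 'a) quandle_structure" where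
  "product_quandle I Q =
     \<lparr>carrier = (\<Pi>\<^sub>E i\<in>I. carrier (Q i)),
      act = (\<lambda>x. \<lambda>y\<in>(\<Pi>\<^sub>E i\<in>I. carrier (Q i)). \<lambda>i\<in>I. act (Q i) (x i) (y i))\<rparr>"

definition discrete_torus :: "nat \<Rightarrow> (nat \<Rightarrow> nat) \<Rightarrow> (nat \<Rightarrow> int) quandle_structure" where
  "discrete_torus n u = product_quandle {1..n} (\<lambda>k. dihedral_quandle (u k))"

lemma quandle_dihedral_quandle:
  assumes "m > 0"
  shows "quandle (dihedral_quandle m)"
proof
  show "carrier (dihedral_quandle m) \<noteq> {}"
    using assms by (auto simp: dihedral_quandle_def)
next
  fix x assume "x \<in> carrier (dihedral_quandle m)"
  then show "act (dihedral_quandle m) x x = x"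
    by (auto simp: dihedral_quandle_def)
next
  fix x assume x: "x \<in> carrier (dihedral_quandle m)"
  have invol: "(2 * x - (2 * x - g) mod int m) mod int m = g" if "g \<in> {0..<int m}" for g
    using that by (simp add: mod_diff_right_eq)
  have "bij_betw (\<lambda>g\<in>{0..<int m}. (2 * x - g) mod int m) {0..<int m} {0..<int m}"
    by (rule bij_betw_byWitness[where f' = "\<lambda>g. (2 * x - g) mod int m"])
      (use assms invol in auto)
  then show "act (dihedral_quandle m) x \<in> Bij (carrier (dihedral_quandle m))"
    by (simp add: dihedral_quandle_def Bij_def)
next
  fix x y z
  assume "x \<in> carrier (dihedral_quandle m)" "y \<in> carrier (dihedral_quandle m)"
    "z \<in> carrier (dihedral_quandle m)"
  moreover have "(2 * x - (2 * y - z) mod int m) mod int m =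
      (2 * ((2 * x - y) mod int m) - (2 * x - z) mod int m) mod int m"
  proof -
    have "(2 * x - (2 * y - z) mod int m) mod int m = (2 * x - (2 * y - z)) mod int m"
      by (rule mod_diff_right_eq)
    also have "2 * x - (2 * y - z) = 2 * (2 * x - y) - (2 * x - z)"
      by simp
    also have "\<dots> mod int m
        = (2 * (2 * x - y) mod int m - (2 * x - z) mod int m) mod int m"
      by (rule mod_diff_eq[symmetric])
    also have "2 * (2 * x - y) mod int m = 2 * ((2 * x - y) mod int m) mod int m"
      by (rule mod_mult_right_eq[symmetric])
    finally show ?thesis
      by (simp only: mod_diff_left_eq)
  qed
  ultimately show "act (dihedral_quandle m) x (act (dihedral_quandle m) y z) =
      act (dihedral_quandle m) (act (dihedral_quandle m) x y) (act (dihedral_quandle m) x z)"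
    using assms by (simp add: dihedral_quandle_def)
qed

lemma quandle_product_quandle:
  assumes "\<And>i. i \<in> I \<Longrightarrow> quandle (Q i)"
  shows "quandle (product_quandle I Q)"
proof -
  let ?X = "\<Pi>\<^sub>E i\<in>I. carrier (Q i)"
  have bij: "bij_betw (act (Q i) a) (carrier (Q i)) (carrier (Q i))"
    if "i \<in> I" "a \<in> carrier (Q i)" for i a
    using quandle.act_Bij[OF assms[OF that(1)] that(2)] by (simp add: Bij_def)
  have mem: "act (Q i) a b \<in> carrier (Q i)"
    if "i \<in> I" "a \<in> carrier (Q i)" "b \<in> carrier (Q i)" for i a b
    using bij[OF that(1,2)] that(3) by (auto simp: bij_betw_def)
  have closed: "(\<lambda>i\<in>I. act (Q i) (x i) (y i)) \<in> ?X" if "x \<in> ?X" "y \<in> ?X" for x y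
    using that mem by (auto simp: PiE_iff)
  show ?thesis
  proof
    show "carrier (product_quandle I Q) \<noteq> {}"
      using quandle.nonempty[OF assms] by (simp add: product_quandle_def PiE_eq_empty_iff)
  next
    fix x assume "x \<in> carrier (product_quandle I Q)"
    then show "act (product_quandle I Q) x x = x"
      using quandle.act_self[OF assms]
      by (auto simp: product_quandle_def PiE_iff extensional_def fun_eq_iff)
  next
    fix x assume "x \<in> carrier (product_quandle I Q)"
    then have x: "x \<in> ?X" by (simp add: product_quandle_def)
    have xi: "x i \<in> carrier (Q i)" if "i \<in> I" for i using x that by auto
    let ?f = "\<lambda>y\<in>?X. \<lambda>i\<in>I. act (Q i) (x i) (y i)"
    let ?g = "\<lambda>y. \<lambda>i\<in>I. inv_into (carrier (Q i)) (act (Q i) (x i)) (y i)"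
    have inv_mem: "inv_into (carrier (Q i)) (act (Q i) (x i)) b \<in> carrier (Q i)"
      if "i \<in> I" "b \<in> carrier (Q i)" for i b
      using bij[OF that(1) xi[OF that(1)]] that(2) by (metis bij_betw_imp_surj_on inv_into_into)
    have g_mem: "?g y \<in> ?X" if "y \<in> ?X" for y
      using that inv_mem by (auto simp: PiE_iff)
    have "bij_betw ?f ?X ?X"
    proof (rule bij_betw_byWitness[where f' = ?g])
      show "\<forall>y\<in>?X. ?g (?f y) = y"
      proof
        fix y assume y: "y \<in> ?X"
        then have "?g (?f y) i = y i" for i
          using bij_betw_inv_into_left[OF bij[OF _ xi], of i "y i"]
          by (cases "i \<in> I") (auto simp: PiE_iff extensional_def)
        then show "?g (?f y) = y" by blast
      qed
      show "\<forall>y\<in>?X. ?f (?g y) = y"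
      proof
        fix y assume y: "y \<in> ?X"
        have "?f (?g y) i = y i" for i
          using g_mem[OF y] y bij_betw_inv_into_right[OF bij[OF _ xi], of i "y i"]
          by (cases "i \<in> I") (auto simp: PiE_iff extensional_def)
        then show "?f (?g y) = y" by blast
      qed
      show "?f ` ?X \<subseteq> ?X" using closed[OF x] by (simp add: image_subset_iff)
      show "?g ` ?X \<subseteq> ?X" using g_mem by (simp only: image_subset_iff) blast
    qed
    then show "act (product_quandle I Q) x \<in> Bij (carrier (product_quandle I Q))"
      by (simp add: product_quandle_def Bij_def)
  next
    fix x y z
    assume "x \<in> carrier (product_quandle I Q)" "y \<in> carrier (product_quandle I Q)"
      "z \<in> carrier (product_quandle I Q)"
    then have "x \<in> ?X" "y \<in> ?X" "z \<in> ?X" by (simp_all add: product_quandle_def)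
    then show "act (product_quandle I Q) x (act (product_quandle I Q) y z) =
        act (product_quandle I Q) (act (product_quandle I Q) x y) (act (product_quandle I Q) x z)"
      using closed quandle.act_act[OF assms]
      by (auto simp: product_quandle_def PiE_iff fun_eq_iff)
  qed
qed

lemma quandle_discrete_torus:
  assumes "\<And>k. k \<in> {1..n} \<Longrightarrow> u k > 0"
  shows "quandle (discrete_torus n u)"
  unfolding discrete_torus_def
  by (intro quandle_product_quandle quandle_dihedral_quandle assms)


section \<open>The topological Euler characteristic\<close>

text \<open>
  Linear independence over $\mathbb{Z}$ of a finite subset of an abelian group
  (written multiplicatively, as the homology groups of HOL-Homology are).
\<close>

definition int_independent :: "('a, 'b) monoid_scheme \<Rightarrow> 'a set \<Rightarrow> bool" where
  "int_independent G S \<longleftrightarrow> finite S \<and> S \<subseteq> carrier G \<and>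
     (\<forall>c :: 'a \<Rightarrow> int. finprod G (\<lambda>x. x [^]\<^bsub>G\<^esub> c x) S = \<one>\<^bsub>G\<^esub> \<longrightarrow> (\<forall>x\<in>S. c x = 0))"

definition abelian_rank :: "('a, 'b) monoid_scheme \<Rightarrow> enat" where
  "abelian_rank G = (SUP S\<in>{S. int_independent G S}. enat (card S))"

definition betti :: "nat \<Rightarrow> 'a topology \<Rightarrow> enat" where
  "betti p X = abelian_rank (homology_group (int p) X)"

text \<open>
  The Euler characteristic is only meaningful for spaces satisfying the following condition;
  otherwise \<open>top_euler_char\<close> below is a junk value.
\<close>

definition finite_betti :: "'a topology \<Rightarrow> bool" where
  "finite_betti X \<longleftrightarrow> (\<forall>p. betti p X \<noteq> \<infinity>) \<and> finite {p. betti p X \<noteq> 0}"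

definition top_euler_char :: "'a topology \<Rightarrow> int" where
  "top_euler_char X = (\<Sum>p | betti p X \<noteq> 0. (-1) ^ p * int (the_enat (betti p X)))"

definition torus :: "nat \<Rightarrow> (nat \<Rightarrow> complex) topology" where
  "torus n = product_topology (\<lambda>_. top_of_set (sphere 0 1)) {1..n}"

end

theory Submission
  imports Defs "HOL-Analysis.Complex_Analysis_Basics"
begin

text \<open>
  Both Euler characteristics vanish, for independent reasons.

  On the quandle side it suffices to exhibit one displacement without fixed points, and the
  translation by \<open>2\<close> in all coordinates is one
  (\<open>quandle_euler_char_discrete_torus\<close>).

  On the topological side, the integral homology of the torus is computed completely. A circle
  factor has the effect \<open>H\<^sub>p(X \<times> S\<^sup>1) \<cong> H\<^sub>p(X) \<times> H\<^bsub>p-1\<^esub>(X)\<close> (\<open>homology_group_prod_circle\<close>), which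
  follows from the Eilenberg-Steenrod axioms by cutting the circle into contractible arcs. By
  induction \<open>H\<^sub>p(T\<^sup>n)\<close> is free abelian of rank \<open>n choose p\<close> (\<open>homology_group_torus\<close>). That a free
  abelian group on \<open>k\<close> generators has no independent set with more than \<open>k\<close> elements is linear
  algebra over the integers (\<open>int_vectors_dependent\<close>), so the Betti numbers are the binomial
  coefficients, and their alternating sum is \<open>0\<close> for \<open>n > 0\<close>.
\<close>

section \<open>Ranks of abelian groups\<close>

text \<open>
  More integer vectors than coordinates are linearly dependent over the integers. The induction on
  the set of coordinates is fraction-free Gaussian elimination: a vector \<open>v t0\<close> that is non-zero in
  coordinate \<open>a\<close> serves as pivot, and it clears coordinate \<open>a\<close> from the other vectors.
\<close>
lemma int_vectors_dependent:
  fixes v :: "'i \<Rightarrow> 's \<Rightarrow> int"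
  assumes "finite S" and "finite T" and "card S < card T"
  shows "\<exists>c. (\<exists>t\<in>T. c t \<noteq> 0) \<and> (\<forall>s\<in>S. (\<Sum>t\<in>T. c t * v t s) = 0)"
  using assms
proof (induction S arbitrary: T v rule: finite_induct)
  case empty
  then show ?case by (intro exI[of _ "\<lambda>_. 1"]) (auto simp: card_gt_0_iff)
next
  case (insert a S)
  show ?case
  proof (cases "\<forall>t\<in>T. v t a = 0")
    case True
    obtain c where "\<exists>t\<in>T. c t \<noteq> 0" "\<forall>s\<in>S. (\<Sum>t\<in>T. c t * v t s) = 0"
      using insert.IH[of T v] insert.prems insert.hyps by auto
    with True show ?thesis by (intro exI[of _ c]) auto
  next
    case False
    then obtain t0 where t0: "t0 \<in> T" "v t0 a \<noteq> 0" by blast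
    define T' where "T' = T - {t0}"
    have T': "finite T'" "T = insert t0 T'" "t0 \<notin> T'" "card S < card T'"
      using insert.prems insert.hyps t0 by (auto simp: T'_def)
    obtain c where c: "\<exists>t\<in>T'. c t \<noteq> 0"
      "\<forall>s\<in>S. (\<Sum>t\<in>T'. c t * (v t0 a * v t s - v t a * v t0 s)) = 0"
      using insert.IH[of T' "\<lambda>t s. v t0 a * v t s - v t a * v t0 s"] T' by blast
    \<comment> \<open>The relation between the cleared vectors, rewritten in terms of the original ones; the
      coefficient of the pivot collects all multiples of \<open>v t0\<close> that were subtracted.\<close>
    define c' where "c' = (\<lambda>t. if t = t0 then - (\<Sum>t\<in>T'. c t * v t a) else c t * v t0 a)"
    have sum: "(\<Sum>t\<in>T. c' t * v t s) =
        (\<Sum>t\<in>T'. c t * (v t0 a * v t s - v t a * v t0 s))" for s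
    proof -
      have "(\<Sum>t\<in>T'. c' t * v t s) = (\<Sum>t\<in>T'. c t * v t0 a * v t s)"
        using T'(3) by (intro sum.cong) (auto simp: c'_def)
      then have "(\<Sum>t\<in>T. c' t * v t s) =
          (\<Sum>t\<in>T'. c t * v t0 a * v t s) - (\<Sum>t\<in>T'. c t * v t a) * v t0 s"
        using T' by (simp add: c'_def)
      then show ?thesis
        by (simp add: algebra_simps sum_subtractf sum_distrib_left)
    qed
    have "\<exists>t\<in>T. c' t \<noteq> 0" using c(1) t0(2) T' by (auto simp: c'_def)
    moreover have "(\<Sum>t\<in>T. c' t * v t s) = 0" if "s \<in> insert a S" for s
      using that c(2) by (auto simp: sum)
    ultimately show ?thesis by blast
  qed
qed

lemma hom_finprod_int_pow:
  assumes "comm_group G" "comm_group H" "h \<in> hom G H" "finite A" "f \<in> A \<rightarrow> carrier G"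
  shows "h (finprod G (\<lambda>x. f x [^]\<^bsub>G\<^esub> (c x :: int)) A) = finprod H (\<lambda>x. h (f x) [^]\<^bsub>H\<^esub> c x) A"
proof -
  interpret G: comm_group G by fact
  interpret H: comm_group H by fact
  interpret h: group_hom G H h using assms(3) by unfold_locales
  show ?thesis
    using assms(4,5)
  proof (induction A rule: finite_induct)
    case (insert a A)
    then have "f \<in> A \<rightarrow> carrier G" "f a \<in> carrier G" by auto
    with insert show ?case by (simp add: Pi_iff h.hom_int_pow)
  qed simp
qed

lemma int_independent_iso_image:
  assumes "comm_group G" "comm_group H" "h \<in> iso G H" "int_independent G S"
  shows "int_independent H (h ` S)"
  unfolding int_independent_def
proof (intro conjI allI impI)
  interpret G: comm_group G by fact
  interpret H: comm_group H by fact
  have S: "finite S" "S \<subseteq> carrier G" using assms(4) by (auto simp: int_independent_def)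
  have h: "h \<in> hom G H" "inj_on h (carrier G)" using assms(3) by (auto simp: iso_def bij_betw_def)
  have inj: "inj_on h S" using h(2) S(2) inj_on_subset by blast
  show "finite (h ` S)" "h ` S \<subseteq> carrier H" using S h by (auto simp: hom_in_carrier)
  fix c :: "'c \<Rightarrow> int"
  assume "finprod H (\<lambda>x. x [^]\<^bsub>H\<^esub> c x) (h ` S) = \<one>\<^bsub>H\<^esub>"
  then have "finprod H (\<lambda>x. h x [^]\<^bsub>H\<^esub> c (h x)) S = \<one>\<^bsub>H\<^esub>"
    using inj S h by (subst (asm) H.finprod_reindex) (auto simp: hom_in_carrier)
  then have "h (finprod G (\<lambda>x. x [^]\<^bsub>G\<^esub> c (h x)) S) = \<one>\<^bsub>H\<^esub>"
    using hom_finprod_int_pow[OF assms(1,2) h(1) S(1), of "\<lambda>x. x" "c \<circ> h"] S by auto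
  also have "\<dots> = h \<one>\<^bsub>G\<^esub>" using h(1) by (simp add: hom_one)
  finally have "finprod G (\<lambda>x. x [^]\<^bsub>G\<^esub> c (h x)) S = \<one>\<^bsub>G\<^esub>"
    using h(2) S by (elim inj_onD) (auto intro!: G.finprod_closed)
  then have "\<forall>x\<in>S. c (h x) = 0"
    using assms(4) unfolding int_independent_def by (elim conjE allE[of _ "c \<circ> h"]) auto
  then show "\<forall>y\<in>h ` S. c y = 0" by blast
qed

lemma abelian_rank_mono_iso:
  assumes "comm_group G" "comm_group H" "h \<in> iso G H"
  shows "abelian_rank G \<le> abelian_rank H"
  unfolding abelian_rank_def
proof (rule SUP_mono)
  fix S assume "S \<in> {S. int_independent G S}"
  moreover then have "card (h ` S) = card S"
    using assms(3) by (intro card_image) (auto simp: iso_def bij_betw_def int_independent_def intro: inj_on_subset)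
  ultimately show "\<exists>T\<in>{S. int_independent H S}. enat (card S) \<le> enat (card T)"
    using int_independent_iso_image[OF assms] by (intro bexI[of _ "h ` S"]) auto
qed

lemma abelian_rank_iso:
  assumes "comm_group G" "comm_group H" "G \<cong> H"
  shows "abelian_rank G = abelian_rank H"
proof -
  obtain h where h: "h \<in> iso G H" using assms(3) by (auto simp: is_iso_def)
  then have "inv_into (carrier G) h \<in> iso H G"
    using assms(1) by (intro group.iso_set_sym) (auto simp: comm_group_def)
  with h show ?thesis using abelian_rank_mono_iso assms by (metis antisym)
qed

lemma finprod_free_Abelian_group:
  assumes "finite A" "f \<in> A \<rightarrow> carrier (free_Abelian_group S)"
  shows "finprod (free_Abelian_group S) f A = sum f A"
proof -
  interpret comm_group "free_Abelian_group S" by (rule abelian_free_Abelian_group)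
  show ?thesis using assms
    by (induction A rule: finite_induct) (auto simp: Pi_iff)
qed

text \<open>
  The generators are independent, which bounds the rank from below. For the upper bound,
  the elements of the group are integer vectors with coordinates in \<open>S\<close>, to which
  \<open>int_vectors_dependent\<close> applies.
\<close>
lemma abelian_rank_free_Abelian_group:
  assumes "finite S"
  shows "abelian_rank (free_Abelian_group S) = enat (card S)"
proof (rule antisym)
  have lookup: "poly_mapping.lookup (finprod (free_Abelian_group S) (\<lambda>x. x [^]\<^bsub>free_Abelian_group S\<^esub> c x) B) s
      = (\<Sum>x\<in>B. c x * poly_mapping.lookup x s)"
    if "finite B" "B \<subseteq> carrier (free_Abelian_group S)" for B s and c :: "_ \<Rightarrow> int"
  proof -
    have "finprod (free_Abelian_group S) (\<lambda>x. x [^]\<^bsub>free_Abelian_group S\<^esub> c x) B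
        = (\<Sum>x\<in>B. x [^]\<^bsub>free_Abelian_group S\<^esub> c x)"
      using that by (intro finprod_free_Abelian_group) (auto intro!: group.int_pow_closed)
    also have "\<dots> = (\<Sum>x\<in>B. frag_cmul (c x) x)"
      using that by (intro sum.cong) auto
    finally show ?thesis by (simp add: lookup_sum)
  qed
  show "abelian_rank (free_Abelian_group S) \<le> enat (card S)"
    unfolding abelian_rank_def
  proof (rule SUP_least)
    fix B assume "B \<in> {B. int_independent (free_Abelian_group S) B}"
    then have B: "finite B" "B \<subseteq> carrier (free_Abelian_group S)"
      and ind: "\<And>c::_ \<Rightarrow> int. finprod (free_Abelian_group S) (\<lambda>x. x [^]\<^bsub>free_Abelian_group S\<^esub> c x) B = 0 \<Longrightarrow> \<forall>x\<in>B. c x = 0"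
      by (auto simp: int_independent_def)
    have "\<not> card S < card B"
    proof
      assume "card S < card B"
      then obtain c where c: "\<exists>x\<in>B. c x \<noteq> 0" "\<forall>s\<in>S. (\<Sum>x\<in>B. c x * poly_mapping.lookup x s) = 0"
        using int_vectors_dependent[OF assms B(1), of poly_mapping.lookup] by blast
      have "(\<Sum>x\<in>B. c x * poly_mapping.lookup x s) = 0" for s
      proof (cases "s \<in> S")
        case False
        have "poly_mapping.lookup x s = 0" if "x \<in> B" for x
          using False that B(2) by (auto simp: in_keys_iff subset_iff)
        then show ?thesis by simp
      qed (use c in auto)
      then have "finprod (free_Abelian_group S) (\<lambda>x. x [^]\<^bsub>free_Abelian_group S\<^esub> c x) B = 0"
        by (intro poly_mapping_eqI) (simp add: lookup B)
      with ind c(1) show False by blast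
    qed
    then show "enat (card B) \<le> enat (card S)" by simp
  qed
  have "int_independent (free_Abelian_group S) (frag_of ` S)"
    unfolding int_independent_def
  proof (intro conjI allI impI)
    fix c :: "_ \<Rightarrow> int"
    assume 0: "finprod (free_Abelian_group S) (\<lambda>x. x [^]\<^bsub>free_Abelian_group S\<^esub> c x) (frag_of ` S)
       = \<one>\<^bsub>free_Abelian_group S\<^esub>"
    have "c (frag_of s) = 0" if "s \<in> S" for s
    proof -
      have "(\<Sum>x\<in>frag_of ` S. c x * poly_mapping.lookup x s) = 0"
      proof -
        have "frag_of ` S \<subseteq> carrier (free_Abelian_group S)" by auto
        then show ?thesis using lookup[of "frag_of ` S" c s] 0 assms by simp
      qed
      then have "(\<Sum>t\<in>S. c (frag_of t) * poly_mapping.lookup (frag_of t) s) = 0"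
        by (subst (asm) sum.reindex) (auto simp: inj_on_def frag_of_eq)
      then show ?thesis using assms that by (simp add: if_distrib when_def cong: if_cong)
    qed
    then show "\<forall>x\<in>frag_of ` S. c x = 0" by blast
  qed (use assms in auto)
  moreover have "card (frag_of ` S) = card S"
    by (intro card_image) (auto simp: inj_on_def frag_of_eq)
  ultimately show "enat (card S) \<le> abelian_rank (free_Abelian_group S)"
    unfolding abelian_rank_def by (metis SUP_upper mem_Collect_eq)
qed

lemma free_Abelian_group_disjoint_Un:
  assumes "S \<inter> T = {}"
  shows "free_Abelian_group S \<times>\<times> free_Abelian_group T \<cong> free_Abelian_group (S \<union> T)"
proof (rule is_isoI)
  let ?h = "\<lambda>(x, y). x + y"
  have keys_Un: "Poly_Mapping.keys (x + y) \<subseteq> S \<union> T"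
    if "Poly_Mapping.keys x \<subseteq> S" "Poly_Mapping.keys y \<subseteq> T" for x y :: "'a \<Rightarrow>\<^sub>0 int"
    using that keys_add[of x y] by blast
  have "?h \<in> hom (free_Abelian_group S \<times>\<times> free_Abelian_group T) (free_Abelian_group (S \<union> T))"
  proof (rule homI)
    show "?h z \<in> carrier (free_Abelian_group (S \<union> T))"
      if "z \<in> carrier (free_Abelian_group S \<times>\<times> free_Abelian_group T)" for z
      using that keys_Un by (cases z) simp
  qed (auto simp: algebra_simps)
  moreover have "inj_on ?h (carrier (free_Abelian_group S \<times>\<times> free_Abelian_group T))"
  proof (rule inj_onI, clarsimp)
    fix x y x' y' :: "'a \<Rightarrow>\<^sub>0 int"
    assume k: "Poly_Mapping.keys x \<subseteq> S" "Poly_Mapping.keys y \<subseteq> T"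
      "Poly_Mapping.keys x' \<subseteq> S" "Poly_Mapping.keys y' \<subseteq> T" and eq: "x + y = x' + y'"
    have diff: "x - x' = y' - y" using eq by (simp add: algebra_simps)
    have "Poly_Mapping.keys (x - x') \<subseteq> S" "Poly_Mapping.keys (y' - y) \<subseteq> T"
      using k keys_diff[of x x'] keys_diff[of y' y] by auto
    then have "Poly_Mapping.keys (x - x') \<subseteq> S \<inter> T" by (simp add: diff)
    then have "x - x' = 0" using assms by (simp del: right_minus_eq)
    then show "x = x' \<and> y = y'" using eq by simp
  qed
  moreover have "?h ` carrier (free_Abelian_group S \<times>\<times> free_Abelian_group T) = carrier (free_Abelian_group (S \<union> T))"
  proof
    show "?h ` carrier (free_Abelian_group S \<times>\<times> free_Abelian_group T) \<subseteq> carrier (free_Abelian_group (S \<union> T))"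
    proof clarify
      fix x y assume "(x, y) \<in> carrier (free_Abelian_group S \<times>\<times> free_Abelian_group T)"
      then show "x + y \<in> carrier (free_Abelian_group (S \<union> T))" using keys_Un by simp
    qed
    show "carrier (free_Abelian_group (S \<union> T)) \<subseteq> ?h ` carrier (free_Abelian_group S \<times>\<times> free_Abelian_group T)"
    proof
      fix c assume "c \<in> carrier (free_Abelian_group (S \<union> T))"
      then have "Poly_Mapping.keys c \<subseteq> S \<union> T" by simp
      then obtain d e where "Poly_Mapping.keys d \<subseteq> S" "Poly_Mapping.keys e \<subseteq> T" "d + e = c"
        by (rule frag_split)
      then show "c \<in> ?h ` carrier (free_Abelian_group S \<times>\<times> free_Abelian_group T)"
        by (intro image_eqI[of _ _ "(d, e)"]) auto
    qed
  qed
  ultimately show "?h \<in> iso (free_Abelian_group S \<times>\<times> free_Abelian_group T) (free_Abelian_group (S \<union> T))"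
    by (simp add: iso_def bij_betw_def)
qed

lemma free_Abelian_group_lessThan_add:
  "free_Abelian_group {..<a::nat} \<times>\<times> free_Abelian_group {..<b::nat} \<cong> free_Abelian_group {..<a + b}"
proof -
  have "{..<b} \<approx> {a..<a+b}"
    by (simp add: eqpoll_iff_card)
  then have "free_Abelian_group {..<b} \<cong> free_Abelian_group {a..<a+b}"
    by (simp add: isomorphic_free_Abelian_groups)
  then have "free_Abelian_group {..<a} \<times>\<times> free_Abelian_group {..<b}
      \<cong> free_Abelian_group {..<a} \<times>\<times> free_Abelian_group {a..<a+b}"
    by (intro group.DirProd_iso_trans iso_refl) auto
  also have "\<dots> \<cong> free_Abelian_group ({..<a} \<union> {a..<a+b})"
    by (rule free_Abelian_group_disjoint_Un) auto
  also have "{..<a} \<union> {a..<a+b} = {..<a+b}" by auto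
  finally show ?thesis .
qed

section \<open>Homology of products and triples\<close>

text \<open>
  Contracting \<open>K\<close>, respectively \<open>T\<close>, to one and the same point \<open>t\<close> of \<open>T\<close> in the second coordinate
  shows that \<open>X \<times> T \<rightarrow> X \<times> K\<close> is a homotopy equivalence, so the pair has no relative homology.
\<close>
lemma trivial_homology_prod_contractible_pair:
  fixes X :: "'a topology" and K :: "'b topology"
  assumes "contractible_space K" and "contractible_space (subtopology K T)"
    and "T \<subseteq> topspace K" and "T \<noteq> {}"
  shows "trivial_group (relative_homology_group p (prod_topology X K) (topspace X \<times> T))"
proof -
  obtain t where t: "t \<in> T" using assms by blast
  define f where "f = (\<lambda>z::'a \<times> 'b. (fst z, t))"
  have K: "homotopic_with (\<lambda>_. True) K K (\<lambda>_. t) id"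
    using assms t by (metis contractible_space_alt homotopic_with_sym subset_eq empty_iff)
  have T: "homotopic_with (\<lambda>_. True) (subtopology K T) (subtopology K T) (\<lambda>_. t) id"
  proof -
    have "t \<in> topspace (subtopology K T)" using t assms by auto
    then show ?thesis using assms(2)
      by (metis contractible_space_alt homotopic_with_sym)
  qed
  have sub: "subtopology (prod_topology X K) (topspace X \<times> T) = prod_topology X (subtopology K T)"
    by (simp add: subtopology_Times)
  have h: "homotopic_with (\<lambda>_. True) (prod_topology X L) (prod_topology X L) f id"
    if "homotopic_with (\<lambda>_. True) L L (\<lambda>_. t) id" for L :: "'b topology"
  proof -
    have "homotopic_with (\<lambda>_. True) X X id id" by simp
    from homotopic_with_prod_topology[OF this that, of "\<lambda>_. True"]
    show ?thesis by (simp add: f_def id_def case_prod_unfold)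
  qed
  show ?thesis
  proof (rule trivial_relative_homology_group_gen)
    show "continuous_map (prod_topology X K) (subtopology (prod_topology X K) (topspace X \<times> T)) f"
      unfolding sub f_def using t assms
      by (auto simp: continuous_map_pairwise o_def continuous_map_fst continuous_map_in_subtopology)
  qed (use h K T sub in auto)
qed

lemma homology_prod_contractible_iso:
  assumes "contractible_space K" and "topspace K \<noteq> {}"
  shows "homology_group p (prod_topology X K) \<cong> homology_group p X"
proof -
  obtain k where k: "k \<in> topspace K" using assms by blast
  have "homotopic_with (\<lambda>_. True) K K (\<lambda>_. k) id"
    using assms k by (metis contractible_space_alt homotopic_with_sym)
  then have 1: "homotopic_with (\<lambda>_. True) (prod_topology X K) (prod_topology X K) (\<lambda>z. (fst z, k)) id"
    using homotopic_with_prod_topology[of "\<lambda>_. True" X X id id "\<lambda>_. True" K K "\<lambda>_. k" id "\<lambda>_. True"]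
    by (simp add: id_def case_prod_unfold)
  have "prod_topology X K homotopy_equivalent_space X"
    unfolding homotopy_equivalent_space_def
    by (rule exI[of _ fst], rule exI[of _ "\<lambda>x. (x, k)"])
      (use 1 k in \<open>auto simp: o_def id_def continuous_map_fst continuous_map_pairwise\<close>)
  then show ?thesis by (rule homotopy_equivalent_space_imp_isomorphic_homology_groups)
qed

text \<open>
  The exact sequence of a triple \<open>T \<subseteq> S \<subseteq> X\<close> becomes an isomorphism as soon as one of its three
  terms vanishes. The next two lemmas are the cases where the pair \<open>(S, T)\<close>, respectively
  \<open>(X, T)\<close>, has no homology; the second shifts the degree by one.
\<close>
lemma relative_homology_iso_larger_subspace:
  assumes "T \<subseteq> S" and "\<And>q. trivial_group (relative_homology_group q (subtopology X S) T)"
  shows "relative_homology_group p X T \<cong> relative_homology_group p X S"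
proof -
  have "exact_seq ([relative_homology_group (p-1) (subtopology X S) T, relative_homology_group p X S,
       relative_homology_group p X T, relative_homology_group p (subtopology X S) T],
     [hom_relboundary p X S T, hom_induced p X T X S id, hom_induced p (subtopology X S) T X T id])"
    using homology_exactness_triple_1[OF assms(1)] homology_exactness_triple_3[OF assms(1)]
    by (simp add: exact_seq_cons_iff)
  from very_short_exact_sequence[OF this] show ?thesis
    using assms(2) by (auto intro: is_isoI)
qed

lemma relative_homology_iso_connecting:
  assumes "T \<subseteq> S" and "\<And>q. trivial_group (relative_homology_group q X T)"
  shows "relative_homology_group p X S \<cong> relative_homology_group (p-1) (subtopology X S) T"
proof -
  have "exact_seq ([relative_homology_group (p-1) X T, relative_homology_group (p-1) (subtopology X S) T, 
       relative_homology_group p X S, relative_homology_group p X T],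
     [hom_induced (p-1) (subtopology X S) T X T id, hom_relboundary p X S T, hom_induced p X T X S id])"
    using homology_exactness_triple_1[OF assms(1)] homology_exactness_triple_2[OF assms(1)]
    by (simp add: exact_seq_cons_iff)
  from very_short_exact_sequence[OF this] show ?thesis
    using assms(2) by (auto intro: is_isoI)
qed

section \<open>Contractible arcs and the homology of a product with the circle\<close>

text \<open>
  The straight-line homotopy towards \<open>a\<close> stays in \<open>C\<close> and hence avoids \<open>0\<close>, so it can be projected
  radially back to the sphere; being a cone, \<open>C\<close> contains this projection. Every arc of the circle
  that is needed below has this form.
\<close>
lemma contractible_sphere_Int_starlike_cone:
  fixes a :: "'a::real_normed_vector"
  assumes a: "a \<in> C" and nz: "0 \<notin> C"
    and star: "\<And>x. x \<in> C \<Longrightarrow> closed_segment a x \<subseteq> C"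
    and cone: "\<And>x c. x \<in> C \<Longrightarrow> c > 0 \<Longrightarrow> c *\<^sub>R x \<in> C"
  shows "contractible (sphere 0 1 \<inter> C)"
proof -
  let ?S = "sphere 0 1 \<inter> C"
  let ?g = "\<lambda>(t::real, x). (1 - t) *\<^sub>R x + t *\<^sub>R a"
  have inC: "?g (t, x) \<in> C" if "t \<in> {0..1}" "x \<in> C" for t x
  proof -
    have "?g (t, x) \<in> closed_segment a x"
      using that(1) unfolding in_segment by (intro exI[of _ "1 - t"]) auto
    then show ?thesis using star[OF that(2)] by blast
  qed
  have sgnC: "sgn x \<in> ?S" if "x \<in> C" for x
  proof -
    have "x \<noteq> 0" using nz that by blast
    then show ?thesis using cone[OF that, of "inverse (norm x)"]
      by (simp add: norm_sgn) (simp add: sgn_div_norm)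
  qed
  have "homotopic_with (\<lambda>_. True) (top_of_set ?S) (top_of_set ?S) id (\<lambda>_. sgn a)"
  proof (subst homotopic_with, simp, intro exI conjI ballI TrueI)
    have "continuous_on ({0..1} \<times> ?S) (sgn \<circ> ?g)"
    proof -
      have "continuous_on ({0..1} \<times> ?S) ?g"
        by (auto simp: case_prod_unfold intro!: continuous_intros)
      moreover have "\<forall>z\<in>{0..1} \<times> ?S. ?g z \<noteq> 0"
        using inC nz by auto (metis)
      ultimately show ?thesis unfolding o_def by (intro continuous_on_sgn) auto
    qed
    then show "continuous_map (prod_topology (top_of_set {0..1}) (top_of_set ?S)) (top_of_set ?S) (sgn \<circ> ?g)"
      using inC sgnC by (auto simp: Pi_iff) 
  qed (auto simp: sgn_div_norm)
  then show ?thesis unfolding contractible_def by blast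
qed


abbreviation circle :: "complex topology" where "circle \<equiv> top_of_set (sphere 0 1)"

lemma unit_complex_real_cases:
  assumes "norm z = 1" and "Im z = 0"
  shows "z = 1 \<or> z = -1"
proof -
  have "\<bar>Re z\<bar> = 1" using assms by (simp add: cmod_def)
  then show ?thesis using assms by (auto simp: complex_eq_iff abs_if split: if_splits)
qed

text \<open>
  The plane slit along the closed ray from \<open>0\<close> through \<open>s\<close> is a cone that is starlike about \<open>-s\<close>,
  and it meets the circle in everything but \<open>s\<close>.
\<close>
lemma contractible_circle_minus_point:
  fixes s :: complex
  assumes "s = 1 \<or> s = -1"
  shows "contractible (sphere 0 1 - {s})"
proof -
  have "contractible (sphere 0 1 \<inter> {z. Im z \<noteq> 0 \<or> Re (s * z) < 0})"
  proof (rule contractible_sphere_Int_starlike_cone[where a = "-s"])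
    show "closed_segment (-s) x \<subseteq> {z. Im z \<noteq> 0 \<or> Re (s * z) < 0}"
      if "x \<in> {z. Im z \<noteq> 0 \<or> Re (s * z) < 0}" for x
    proof
      fix z assume "z \<in> closed_segment (-s) x"
      then obtain u where u: "0 \<le> u" "u \<le> 1" "z = (1 - u) *\<^sub>R (-s) + u *\<^sub>R x"
        unfolding in_segment by blast
      have Im: "Im z = u * Im x" and Re: "Re (s * z) = - (1 - u) + u * Re (s * x)"
        using assms by (auto simp: u algebra_simps)
      show "z \<in> {z. Im z \<noteq> 0 \<or> Re (s * z) < 0}"
      proof (cases "u = 0")
        case False
        then show ?thesis using that u Im Re 
          by (auto simp: add_neg_nonpos) (smt (verit) mult_pos_neg)
      qed (use Re in auto)
    qed
    show "c *\<^sub>R x \<in> {z. Im z \<noteq> 0 \<or> Re (s * z) < 0}"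
      if "x \<in> {z. Im z \<noteq> 0 \<or> Re (s * z) < 0}" "c > 0" for x c
    proof -
      have "Re (s * (c *\<^sub>R x)) = c * Re (s * x)" by (simp add: algebra_simps)
      with that show ?thesis by (auto simp: mult_pos_neg simp del: times_complex.sel)
    qed
  qed (use assms in auto)
  also have "sphere 0 1 \<inter> {z. Im z \<noteq> 0 \<or> Re (s * z) < 0} = sphere 0 1 - {s}"
  proof -
    have "Re (s * z) < 0 \<longleftrightarrow> z \<noteq> s" if "norm z = 1" "Im z = 0" for z
      using unit_complex_real_cases[OF that] assms by auto
    moreover have "Im s = 0" using assms by auto
    ultimately show ?thesis by auto
  qed
  finally show ?thesis .
qed

lemma contractible_open_semicircle:
  assumes "s = 1 \<or> s = (-1::real)"
  shows "contractible (sphere 0 1 \<inter> {z. s * Im z > 0})"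
proof (rule contractible_sphere_Int_starlike_cone[where a = "s *\<^sub>R \<i>"])
  show "closed_segment (s *\<^sub>R \<i>) x \<subseteq> {z. s * Im z > 0}" if "x \<in> {z. s * Im z > 0}" for x
  proof (rule closed_segment_subset)
    have "{z. s * Im z > 0} = {z. inner (s *\<^sub>R \<i>) z > 0}" by (simp add: inner_complex_def)
    then show "convex {z. s * Im z > 0}" by (simp only: convex_halfspace_gt)
  qed (use assms that in auto)
qed (use assms in \<open>auto simp: mult.left_commute\<close>)

text \<open>
  This is the one piece of the Kuenneth formula that is needed. The factor \<open>H\<^sub>p(X)\<close> splits off
  because \<open>X \<times> {1}\<close> is a retract of \<open>X \<times> S\<^sup>1\<close>. It remains to identify
  \<open>H\<^sub>p(X \<times> S\<^sup>1, X \<times> {1})\<close> with \<open>H\<^bsub>p-1\<^esub>(X)\<close>. Let \<open>A\<close> and \<open>B\<close> be the circle without \<open>-1\<close> and without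
  \<open>1\<close>, let \<open>W = A \<inter> B\<close>, and let \<open>U\<close> and \<open>L\<close> be the upper and lower open semicircles, so that \<open>W\<close>
  is the disjoint union of \<open>U\<close> and \<open>L\<close>. All of these but \<open>W\<close> are contractible. Leaving out the
  factor \<open>X\<close>, the pair \<open>(S\<^sup>1, {1})\<close> may be replaced by \<open>(S\<^sup>1, A)\<close> and, excising the point \<open>1\<close>, by
  \<open>(B, W)\<close>; the triple \<open>L \<subseteq> W \<subseteq> B\<close> leads to \<open>(W, L)\<close> and lowers the degree by one; and excising
  \<open>L\<close> leaves \<open>U\<close>.
\<close>
lemma homology_group_prod_circle:
  "homology_group p (prod_topology X circle) \<cong> homology_group p X \<times>\<times> homology_group (p - 1) X"
proof -
  define S1 :: "complex set" where "S1 = sphere 0 1"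
  define D where "D = topspace X"
  define A where "A = S1 - {-1}"
  define B where "B = S1 - {1}"
  define W where "W = S1 - {1, -1}"
  define L where "L = S1 \<inter> {z. Im z < 0}"
  define U where "U = S1 \<inter> {z. Im z > 0}"
  let ?P = "\<lambda>K::complex set. prod_topology X (top_of_set K)"
  have sub: "subtopology (?P K) (D \<times> M) = ?P M" if "M \<subseteq> K" for K M
    using that by (simp add: subtopology_Times subtopology_subtopology D_def inf.absorb2)
  have "U \<union> L = W" "U \<inter> L = {}"
    using unit_complex_real_cases by (force simp: U_def L_def W_def S1_def)+
  have contr: "contractible A" "contractible B" "contractible L" "contractible U"
    using contractible_circle_minus_point contractible_open_semicircle[of 1]
      contractible_open_semicircle[of "-1"]
    by (auto simp: A_def B_def L_def U_def S1_def)
  have "\<i> \<in> U" "-\<i> \<in> L" "1 \<in> A" "1 \<in> S1" by (auto simp: U_def L_def S1_def A_def)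

  have split: "homology_group p (?P S1) \<cong>
     homology_group p (?P {1}) \<times>\<times> relative_homology_group p (?P S1) (D \<times> {1})"
  proof -
    have "D \<times> {1} retract_of_space ?P S1"
      unfolding retract_of_space_def
    proof (intro conjI exI[of _ "\<lambda>z. (fst z, 1)"])
      show "continuous_map (?P S1) (subtopology (?P S1) (D \<times> {1})) (\<lambda>z. (fst z, 1))"
        using \<open>1 \<in> S1\<close>
        by (subst sub) (auto simp: continuous_map_pairwise o_def continuous_map_fst)
    qed (use \<open>1 \<in> S1\<close> in \<open>auto simp: D_def\<close>)
    from isomorphic_group_homology_group_prod_retract[OF disjI2, OF this, of p]
    show ?thesis using sub[of "{1}" S1] \<open>1 \<in> S1\<close> by simp
  qed
  have "homology_group p (?P {1}) \<cong> homology_group p X"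
    by (rule homology_prod_contractible_iso) auto
  moreover have "relative_homology_group p (?P S1) (D \<times> {1}) \<cong> homology_group (p - 1) X"
  proof -
    have "relative_homology_group p (?P S1) (D \<times> {1}) \<cong> relative_homology_group p (?P S1) (D \<times> A)"
    proof (rule relative_homology_iso_larger_subspace)
      have "subtopology (?P S1) (D \<times> A) = ?P A" by (rule sub) (auto simp: A_def)
      moreover have "subtopology (top_of_set A) {1} = top_of_set {1}" using \<open>1 \<in> A\<close>
        by (simp add: subtopology_subtopology)
      then have "trivial_group (relative_homology_group q (?P A) (D \<times> {1}))" for q
        using contr \<open>1 \<in> A\<close> unfolding D_def
        by (intro trivial_homology_prod_contractible_pair) auto
      ultimately show
        "trivial_group (relative_homology_group q (subtopology (?P S1) (D \<times> A)) (D \<times> {1}))" for q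
        by simp
    qed (use \<open>1 \<in> A\<close> in auto)
    also have "\<dots> \<cong> relative_homology_group p (?P B) (D \<times> W)"
    proof -
      have "hom_induced p (subtopology (?P S1) (D \<times> S1 - D \<times> {1})) (D \<times> A - D \<times> {1}) (subtopology (?P S1) (D \<times> S1)) (D \<times> A) id
        \<in> iso (relative_homology_group p (subtopology (?P S1) (D \<times> S1 - D \<times> {1})) (D \<times> A - D \<times> {1}))
          (relative_homology_group p (subtopology (?P S1) (D \<times> S1)) (D \<times> A))"
      proof (rule homology_excision_axiom)
        have "openin (top_of_set S1) A"
          unfolding A_def by (metis Diff_eq open_Compl closed_singleton openin_open_Int)
        moreover have "closedin (top_of_set S1) {1}" using \<open>1 \<in> S1\<close> by (simp add: closedin_closed_subset)
        ultimately show "?P S1 closure_of (D \<times> {1}) \<subseteq> ?P S1 interior_of (D \<times> A)"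
          using \<open>1 \<in> A\<close> unfolding D_def closure_of_Times interior_of_Times
          by (simp add: closure_of_closedin interior_of_openin Sigma_mono)
      qed (auto simp: A_def)
      moreover have "D \<times> S1 - D \<times> {1} = D \<times> B" "D \<times> A - D \<times> {1} = D \<times> W"
        by (auto simp: A_def B_def W_def)
      ultimately have "relative_homology_group p (?P B) (D \<times> W) \<cong> relative_homology_group p (?P S1) (D \<times> A)"
        using sub[of S1 S1] sub[of B S1] by (auto intro: is_isoI simp: B_def)
      then show ?thesis by (simp add: group.iso_sym)
    qed
    also have "\<dots> \<cong> relative_homology_group (p - 1) (?P W) (D \<times> L)"
    proof -
      have LW: "L \<subseteq> W" "W \<subseteq> B" using \<open>U \<union> L = W\<close> by (auto simp: W_def B_def)
      have "relative_homology_group p (?P B) (D \<times> W) \<cong>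
         relative_homology_group (p - 1) (subtopology (?P B) (D \<times> W)) (D \<times> L)"
      proof (rule relative_homology_iso_connecting)
        \<comment> \<open>Both \<open>B\<close> and \<open>L\<close> are contractible, so the pair \<open>(X \<times> B, X \<times> L)\<close> has no homology.\<close>
        have "subtopology (top_of_set B) L = top_of_set L" using LW
          by (simp add: subtopology_subtopology inf.absorb2)
        then show "trivial_group (relative_homology_group q (?P B) (D \<times> L))" for q
          using contr \<open>-\<i> \<in> L\<close> LW unfolding D_def
          by (intro trivial_homology_prod_contractible_pair) auto
      qed (use LW in auto)
      then show ?thesis using sub[OF LW(2)] by simp
    qed
    also have "\<dots> \<cong> homology_group (p - 1) (?P U)"
    proof -
      have "hom_induced (p-1) (subtopology (?P W) (D \<times> W - D \<times> L)) (D \<times> L - D \<times> L) (subtopology (?P W) (D \<times> W)) (D \<times> L) id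
        \<in> iso (relative_homology_group (p-1) (subtopology (?P W) (D \<times> W - D \<times> L)) (D \<times> L - D \<times> L))
          (relative_homology_group (p-1) (subtopology (?P W) (D \<times> W)) (D \<times> L))"
      proof (rule homology_excision_axiom)
        \<comment> \<open>Excising all of \<open>X \<times> L\<close> is allowed since \<open>L\<close> is both open and closed in \<open>W\<close>.\<close>
        have "L = W \<inter> {z. Im z < 0}" "L = W \<inter> {z. Im z \<le> 0}"
          using \<open>U \<union> L = W\<close> by (auto simp: L_def U_def)
        then have "openin (top_of_set W) L" "closedin (top_of_set W) L"
          using open_halfspace_Im_lt closed_halfspace_Im_le
          by (metis openin_open_Int, metis closedin_closed_Int)
        then show "?P W closure_of (D \<times> L) \<subseteq> ?P W interior_of (D \<times> L)"
          unfolding D_def closure_of_Times interior_of_Times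
          by (simp add: closure_of_closedin interior_of_openin)
      qed (use \<open>U \<union> L = W\<close> in auto)
      moreover have "D \<times> W - D \<times> L = D \<times> U"
        using \<open>U \<union> L = W\<close> \<open>U \<inter> L = {}\<close> by auto
      ultimately have "homology_group (p - 1) (?P U) \<cong> relative_homology_group (p - 1) (?P W) (D \<times> L)"
        using sub[of W W] sub[of U W] \<open>U \<union> L = W\<close> by (auto intro: is_isoI)
      then show ?thesis by (simp add: group.iso_sym)
    qed
    also have "\<dots> \<cong> homology_group (p - 1) X"
      using contr \<open>\<i> \<in> U\<close> by (intro homology_prod_contractible_iso) auto
    finally show ?thesis .
  qed
  ultimately have "homology_group p (?P {1}) \<times>\<times> relative_homology_group p (?P S1) (D \<times> {1})
      \<cong> homology_group p X \<times>\<times> homology_group (p - 1) X"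
    by (intro group.DirProd_iso_trans) auto
  with split show ?thesis unfolding S1_def by (rule iso_trans)
qed

section \<open>Betti numbers of the torus\<close>

lemma homeomorphic_product_topology_insert:
  assumes "i \<notin> I"
  shows "product_topology Y (insert i I) homeomorphic_space prod_topology (product_topology Y I) (Y i)"
  unfolding homeomorphic_space_def
proof (intro exI)
  show "homeomorphic_maps (product_topology Y (insert i I)) (prod_topology (product_topology Y I) (Y i))
     (\<lambda>x. (restrict x I, x i)) (\<lambda>z. (fst z)(i := snd z))"
    unfolding homeomorphic_maps_def
  proof (intro conjI)
    show "continuous_map (product_topology Y (insert i I)) (prod_topology (product_topology Y I) (Y i))
       (\<lambda>x. (restrict x I, x i))"
      by (auto simp: continuous_map_pairwise o_def continuous_map_componentwise intro: continuous_map_product_projection)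
    show "continuous_map (prod_topology (product_topology Y I) (Y i)) (product_topology Y (insert i I))
       (\<lambda>z. (fst z)(i := snd z))"
      unfolding continuous_map_componentwise
    proof (intro conjI ballI)
      fix k assume k: "k \<in> insert i I"
      show "continuous_map (prod_topology (product_topology Y I) (Y i)) (Y k) (\<lambda>z. ((fst z)(i := snd z)) k)"
      proof (cases "k = i")
        case False
        then have "continuous_map (prod_topology (product_topology Y I) (Y i)) (Y k) ((\<lambda>x. x k) \<circ> fst)"
          using k by (intro continuous_map_compose[OF continuous_map_fst] continuous_map_product_projection) auto
        with False show ?thesis by (simp add: o_def)
      qed (simp add: continuous_map_snd)
    qed (auto simp: PiE_iff extensional_def)
  qed (use assms in \<open>auto simp: PiE_iff extensional_def fun_eq_iff\<close>)
qed

lemma trivial_groups_iso: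
  assumes "trivial_group G" and "trivial_group H"
  shows "G \<cong> H"
proof (rule is_isoI)
  show "(\<lambda>_. \<one>\<^bsub>H\<^esub>) \<in> iso G H"
    using assms by (auto simp: trivial_group_def iso_def hom_def bij_betw_def group.is_monoid)
qed

lemma torus_Suc_homeomorphic: "torus (Suc n) homeomorphic_space prod_topology (torus n) circle"
  using homeomorphic_product_topology_insert[of "Suc n" "{1..n}" "\<lambda>_. circle"]
  by (simp add: torus_def atLeastAtMostSuc_conv)

text \<open>
  Adding a circle factor adds the homology of the torus to itself, shifted by one degree, so the
  ranks obey the recursion of Pascal's triangle. All integer degrees are covered, with the trivial
  group in negative degrees, because the shift leads from degree \<open>0\<close> to degree \<open>-1\<close>.
\<close>
lemma homology_group_torus:
  "homology_group p (torus n) \<cong> free_Abelian_group {..<if p < 0 then 0 else n choose nat p}"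
proof (induction n arbitrary: p)
  case 0
  have X: "topspace (torus 0) = {\<lambda>_. undefined}" by (simp add: torus_def)
  show ?case
  proof (cases "p = 0")
    case True
    have "homology_group 0 (torus 0) \<cong> integer_group" using X by (rule homology_coefficients)
    also have "integer_group \<cong> free_Abelian_group {0::nat}"
      by (rule isomorphic_group_integer_free_Abelian_group_singleton)
    also have "{0} = {..<1::nat}" by auto
    finally show ?thesis using True by simp
  next
    case False
    have "trivial_group (homology_group p (torus 0))" using X False by (rule homology_dimension_axiom)
    moreover have "trivial_group (free_Abelian_group ({} :: nat set))"
      by (auto simp: trivial_group_def)
    moreover have "(if p < 0 then 0 else 0 choose nat p) = 0" using False by auto
    ultimately show ?thesis by (simp add: trivial_groups_iso)
  qed
next
  case (Suc n)
  let ?r = "\<lambda>n p::int. if p < 0 then 0 else n choose nat p"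
  have "homology_group p (torus (Suc n)) \<cong> homology_group p (prod_topology (torus n) circle)"
    by (rule homeomorphic_space_imp_isomorphic_homology_groups[OF torus_Suc_homeomorphic])
  also have "\<dots> \<cong> homology_group p (torus n) \<times>\<times> homology_group (p - 1) (torus n)"
    by (rule homology_group_prod_circle)
  also have "\<dots> \<cong> free_Abelian_group {..<?r n p} \<times>\<times> free_Abelian_group {..<?r n (p - 1)}"
    by (intro group.DirProd_iso_trans Suc) auto
  also have "\<dots> \<cong> free_Abelian_group {..<?r n p + ?r n (p - 1)}"
    by (rule free_Abelian_group_lessThan_add)
  also have "?r n p + ?r n (p - 1) = ?r (Suc n) p"
  proof (cases "p > 0")
    case True
    then obtain k where "nat p = Suc k" "nat (p - 1) = k" using that[of "nat (p - 1)"] by auto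
    with True show ?thesis by simp
  qed (cases "p = 0"; simp)
  finally show ?case .
qed

lemma betti_torus: "betti p (torus n) = enat (n choose p)"
proof -
  have "abelian_rank (homology_group (int p) (torus n)) = abelian_rank (free_Abelian_group {..<n choose p})"
    using homology_group_torus[of "int p" n]
    by (intro abelian_rank_iso abelian_free_Abelian_group) auto
  then show ?thesis by (simp add: betti_def abelian_rank_free_Abelian_group)
qed

lemma nonzero_betti_torus: "{p. betti p (torus n) \<noteq> 0} = {..n}"
  by (auto simp: betti_torus zero_enat_def not_less)

section \<open>Displacements of the discrete torus\<close>

text \<open>
  The displacement \<open>s\<^sub>x \<circ> s\<^sub>y\<^sup>-\<^sup>1\<close> of a dihedral quandle is the translation by \<open>2 (x - y)\<close>. With \<open>x\<close> and
  \<open>y\<close> constant \<open>1\<close> and \<open>0\<close> it translates every coordinate by \<open>2\<close>, which is not \<open>0\<close> modulo any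
  \<open>m > 2\<close>, so it has no fixed point; one coordinate is enough to see this.
\<close>
lemma quandle_euler_char_discrete_torus:
  assumes "n > 0" and "\<And>i. i \<in> {1..n} \<Longrightarrow> u i > 2"
  shows "quandle_euler_char (discrete_torus n u) = 0"
proof -
  let ?Q = "discrete_torus n u"
  let ?G = "BijGroup (carrier ?Q)"
  interpret Q: quandle ?Q using assms(2) by (intro quandle_discrete_torus) force
  define x y :: "nat \<Rightarrow> int" where "x = (\<lambda>i\<in>{1..n}. 1)" and "y = (\<lambda>i\<in>{1..n}. 0)"
  have carr: "carrier ?Q = (\<Pi>\<^sub>E i\<in>{1..n}. {0..<int (u i)})"
    by (simp add: discrete_torus_def product_quandle_def dihedral_quandle_def)
  have act: "act ?Q a b i = (2 * a i - b i) mod int (u i)"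
    if "b \<in> carrier ?Q" "i \<in> {1..n}" for a b i
    using that by (auto simp: discrete_torus_def product_quandle_def dihedral_quandle_def)
  have xy: "x \<in> carrier ?Q" "y \<in> carrier ?Q"
    using assms(2) by (force simp: carr x_def y_def)+
  define g where "g = act ?Q x \<otimes>\<^bsub>?G\<^esub> inv\<^bsub>?G\<^esub> (act ?Q y)"
  have Bij: "act ?Q x \<in> Bij (carrier ?Q)" "act ?Q y \<in> Bij (carrier ?Q)"
    using Q.act_Bij xy by auto
  have inv: "inv\<^bsub>?G\<^esub> (act ?Q y) \<in> carrier ?G"
    using Bij group.inv_closed[OF group_BijGroup] by (simp add: BijGroup_def)
  have carrier_G: "carrier ?G = Bij (carrier ?Q)" by (simp add: BijGroup_def)
  have mult: "(a \<otimes>\<^bsub>?G\<^esub> b) z = a (b z)"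
    if "a \<in> carrier ?G" "b \<in> carrier ?G" "z \<in> carrier ?Q" for a b z
    using that by (simp add: BijGroup_def compose_def)
  have g_in: "g \<in> carrier (displacement_group ?Q)"
  proof -
    have "g \<in> carrier ?G"
      unfolding g_def using Bij inv by (intro monoid.m_closed group.is_monoid group_BijGroup) (auto simp: BijGroup_def)
    then show ?thesis
      unfolding displacement_group_def carrier_subgroup_generated
      by (intro generate.incl) (use xy in \<open>auto simp: g_def\<close>)
  qed
  have "fixed_points g ?Q = {}"
  proof -
    have "g z \<noteq> z" if z: "z \<in> carrier ?Q" for z
    proof
      assume fixed: "g z = z"
      \<comment> \<open>With \<open>w = s\<^sub>y\<^sup>-\<^sup>1(z)\<close>, a fixed point \<open>z\<close> satisfies \<open>s\<^sub>x(w) = s\<^sub>y(w)\<close>, that is,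
        \<open>2 - w \<equiv> - w\<close> in every coordinate.\<close>
      define w where "w = inv_into (carrier ?Q) (act ?Q y) z"
      have bij: "bij_betw (act ?Q y) (carrier ?Q) (carrier ?Q)"
        using Bij by (simp add: Bij_def)
      have w: "w \<in> carrier ?Q" "act ?Q y w = z"
        using bij z by (auto simp: w_def bij_betw_def inv_into_into f_inv_into_f)
      have "g z = act ?Q x ((inv\<^bsub>?G\<^esub> (act ?Q y)) z)"
        using mult[of "act ?Q x" "inv\<^bsub>?G\<^esub> (act ?Q y)" z] Bij(1) inv z
        by (simp add: g_def carrier_G)
      also have "(inv\<^bsub>?G\<^esub> (act ?Q y)) z = w"
        using z by (simp add: inv_BijGroup[OF Bij(2)] w_def)
      finally have "g z = act ?Q x w" .
      then have "act ?Q x w = act ?Q y w" using fixed w by simp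
      then have "(2 * x 1 - w 1) mod int (u 1) = (2 * y 1 - w 1) mod int (u 1)"
        using act[OF w(1), of 1] assms(1) by (metis One_nat_def atLeastAtMost_iff le_refl less_eq_Suc_le)
      then have "int (u 1) dvd 2"
        using assms(1) by (simp add: x_def y_def mod_eq_dvd_iff)
      then have "u 1 \<le> 2" by (auto dest: zdvd_imp_le)
      with assms show False by force
    qed
    then show ?thesis by (auto simp: fixed_points_def)
  qed
  then have "ecard (fixed_points g ?Q) = 0" by (simp add: ecard_def zero_enat_def)
  then show ?thesis
    unfolding quandle_euler_char_def using INF_lower[OF g_in, of "\<lambda>g. ecard (fixed_points g ?Q)"] by simp
qed

section \<open>Vanishing of both Euler characteristics\<close>

theorem theorem1p7:
  fixes n :: nat and u :: "nat \<Rightarrow> nat"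
  assumes "n > 0"
    and "\<And>i. i \<in> {1..n} \<Longrightarrow> u i > 2"
  shows "finite_betti (torus n)
    \<and> ereal_of_enat (quandle_euler_char (discrete_torus n u)) = ereal (real_of_int (top_euler_char (torus n)))
    \<and> top_euler_char (torus n) = 0"
proof -
  have "finite_betti (torus n)"
    unfolding finite_betti_def nonzero_betti_torus by (simp add: betti_torus)
  moreover have "top_euler_char (torus n) = 0"
  proof -
    have "top_euler_char (torus n) = (\<Sum>p\<le>n. (-1) ^ p * int (n choose p))"
      unfolding top_euler_char_def nonzero_betti_torus by (simp add: betti_torus)
    also have "\<dots> = 0" using assms(1) by (rule choose_alternating_sum)
    finally show ?thesis .
  qed
  ultimately show ?thesis
    using quandle_euler_char_discrete_torus[OF assms] by (simp add: zero_ereal_def)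
qed

end
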